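(* Let $d\ge 2$ and let $\|\cdot\|_D$ be a $D$-norm on $\mathbb{R}^d$ such that each bivariate projection $\|\cdot\|_{D_{i,j}}$, $1\le i<j\le d$, is different from the bivariate sup-norm $\|\cdot\|_\infty$ on $\mathbb{R}^2$. Then $\|\cdot\|_D$ is idempotent if and only if $\|\cdot\|_D=\|\cdot\|_1$.
   Context: A generator is a random vector $\bm{Z}=(Z_1,\dots,Z_d)$ with $Z_i\ge 0$ almost surely and $E(Z_i)=1$ for $1\le i\le d$. The $D$-norm on $\mathbb{R}^d$ generated by $\bm{Z}$ is $\|\bm{x}\|_D:=E\left(\max_{1\le i\le d}(|x_i|Z_i)\right)$, $\bm{x}\in\mathbb{R}^d$. A $D$-norm is a norm on $\mathbb{R}^d$ that arises in this way from some generator; the generator of a $D$-norm is not unique. For two $D$-norms $\|\cdot\|_{D^{(1)}}$, $\|\cdot\|_{D^{(2)}}$ on $\mathbb{R}^d$, their product $\|\cdot\|_{D^{(1)}D^{(2)}}$ is the $D$-norm generated by the componentwise product $\bm{Z}^{(1)}\bm{Z}^{(2)}$, where $\bm{Z}^{(1)}$, $\bm{Z}^{(2)}$ are independent generators of $\|\cdot\|_{D^{(1)}}$, $\|\cdot\|_{D^{(2)}}$; it does not depend on the choice of these independent generators. A $D$-norm is called idempotent if $\|\cdot\|_{D^2}:=\|\cdot\|_{DD}=\|\cdot\|_D$. For $1\le i<j\le d$ the bivariate projection of $\|\cdot\|_D$ is the $D$-norm on $\mathbb{R}^2$ defined by $\|(x,y)\|_{D_{i,j}}:=\|x\bm{e}_i+y\bm{e}_j\|_D$,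 $(x,y)\in\mathbb{R}^2$, where $\bm{e}_i$ is the $i$-th unit vector of $\mathbb{R}^d$. Here $\|\bm{x}\|_1=\sum_{i}|x_i|$ and $\|\bm{x}\|_\infty=\max_i|x_i|$. *)

theory Defs
  imports "HOL-Probability.Probability"
begin

text \<open>Vectors of \<open>\<real>\<^sup>d\<close> have type \<^typ>\<open>real ^ 'n\<close> with \<open>d = CARD('n)\<close>.\<close>

definition cmult :: "real ^ 'n \<Rightarrow> real ^ 'n \<Rightarrow> real ^ 'n" where
  "cmult x y = (\<chi> i. x $ i * y $ i)"

text \<open>No separate integrability assumption is needed: the Bochner integral of a
  non-integrable function is \<open>0\<close>.\<close>

definition generator :: "'a measure \<Rightarrow> ('a \<Rightarrow> real ^ 'n) \<Rightarrow> bool" where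
  "generator M Z \<longleftrightarrow> prob_space M \<and> Z \<in> borel_measurable M \<and>
     (\<forall>i. (AE \<omega> in M. 0 \<le> Z \<omega> $ i) \<and> (\<integral>\<omega>. Z \<omega> $ i \<partial>M) = 1)"

definition D_norm :: "'a measure \<Rightarrow> ('a \<Rightarrow> real ^ 'n) \<Rightarrow> real ^ 'n \<Rightarrow> real" where
  "D_norm M Z x = (\<integral>\<omega>. (MAX i. \<bar>x $ i\<bar> * Z \<omega> $ i) \<partial>M)"

text \<open>HOL cannot quantify existentially over the type of the sample space. Passing to the law
  of the generator shows that the sample space \<open>\<real>\<^sup>d\<close> suffices; see
  \<open>is_D_norm_D_norm\<close> below.\<close>

definition is_D_norm :: "(real ^ 'n \<Rightarrow> real) \<Rightarrow> bool" where
  "is_D_norm p \<longleftrightarrow> (\<exists>(M :: (real ^ 'n) measure) Z. generator M Z \<and> p = D_norm M Z)"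

text \<open>Likewise, \<open>\<real>\<^sup>d \<times> \<real>\<^sup>d\<close> suffices as sample space for a pair of independent generators.
  Lemma \<open>D_prod_eq\<close> below shows that the product is well defined, for generators
  on arbitrary sample spaces.\<close>

definition D_prod :: "(real ^ 'n \<Rightarrow> real) \<Rightarrow> (real ^ 'n \<Rightarrow> real) \<Rightarrow> real ^ 'n \<Rightarrow> real" where
  "D_prod p q = (THE r. \<exists>(M :: ((real ^ 'n) \<times> (real ^ 'n)) measure) Z1 Z2.
     generator M Z1 \<and> generator M Z2 \<and> prob_space.indep_var M borel Z1 borel Z2 \<and>
     p = D_norm M Z1 \<and> q = D_norm M Z2 \<and> r = D_norm M (\<lambda>\<omega>. cmult (Z1 \<omega>) (Z2 \<omega>)))"

definition idempotent_D_norm :: "(real ^ 'n \<Rightarrow> real) \<Rightarrow> bool" where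
  "idempotent_D_norm p \<longleftrightarrow> is_D_norm p \<and> D_prod p p = p"

definition bivariate_proj :: "(real ^ 'n \<Rightarrow> real) \<Rightarrow> 'n \<Rightarrow> 'n \<Rightarrow> real ^ 2 \<Rightarrow> real" where
  "bivariate_proj p i j v = p (v $ 1 *\<^sub>R axis i 1 + v $ 2 *\<^sub>R axis j 1)"

definition l1_norm :: "real ^ 'n \<Rightarrow> real" where
  "l1_norm x = (\<Sum>i\<in>UNIV. \<bar>x $ i\<bar>)"

lemma borel_measurable_MAX [measurable]:
  fixes f :: "'n::finite \<Rightarrow> 'a \<Rightarrow> real"
  assumes [measurable]: "\<And>i. f i \<in> borel_measurable M"
  shows "(\<lambda>w. MAX i. f i w) \<in> borel_measurable M"
  by (rule borel_measurable_Max) auto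

lemma borel_measurable_nth_vec [measurable (raw)]:
  fixes Z :: "'a \<Rightarrow> real ^ 'n"
  assumes "Z \<in> borel_measurable M"
  shows "(\<lambda>w. Z w $ i) \<in> borel_measurable M"
  using measurable_compose[OF assms borel_measurable_continuous_onI[of "\<lambda>x::real^'n. x $ i"]]
  by (simp add: continuous_on_component)

lemma borel_measurable_cmult [measurable (raw)]:
  fixes f g :: "'a \<Rightarrow> real ^ 'n"
  assumes [measurable]: "f \<in> borel_measurable M" "g \<in> borel_measurable M"
  shows "(\<lambda>w. cmult (f w) (g w)) \<in> borel_measurable M"
  by (rule borel_measurable_continuous_Pair[OF assms]) (auto simp: cmult_def intro!: continuous_intros)

lemma generatorD:
  assumes "generator M Z"
  shows "prob_space M" "Z \<in> borel_measurable M" "AE \<omega> in M. \<forall>i. 0 \<le> Z \<omega> $ i"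
    "(\<integral>\<omega>. Z \<omega> $ i \<partial>M) = 1" "integrable M (\<lambda>\<omega>. Z \<omega> $ i)"
proof -
  show "(\<integral>\<omega>. Z \<omega> $ i \<partial>M) = 1"
    using assms by (simp add: generator_def)
  then show "integrable M (\<lambda>\<omega>. Z \<omega> $ i)"
    using not_integrable_integral_eq by force
qed (use assms in \<open>auto simp: generator_def AE_all_countable\<close>)

lemma generator_distr:
  assumes "generator M Z"
  shows "generator (distr M borel Z) (\<lambda>x. x)" "D_norm (distr M borel Z) (\<lambda>x. x) = D_norm M Z"
proof -
  note [measurable] = generatorD(2)[OF assms]
  show "generator (distr M borel Z) (\<lambda>x. x)"
    using assms
    by (auto simp: generator_def integral_distr AE_distr_iff intro!: prob_space.prob_space_distr)
  show "D_norm (distr M borel Z) (\<lambda>x. x) = D_norm M Z"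
    by (rule ext) (simp add: D_norm_def integral_distr)
qed

lemma generator_of_distr:
  assumes "prob_space P" "X \<in> borel_measurable P" "generator (distr P borel X) (\<lambda>x. x)"
  shows "generator P X"
  using assms by (auto simp: generator_def integral_distr AE_distr_iff)

lemma is_D_norm_D_norm:
  assumes "generator M Z"
  shows "is_D_norm (D_norm M Z)"
  unfolding is_D_norm_def
  by (intro exI conjI) (rule generator_distr(1)[OF assms], rule generator_distr(2)[OF assms, symmetric])

lemma generator_cmult:
  assumes "generator M Z1" "generator M Z2" "prob_space.indep_var M borel Z1 borel Z2"
  shows "generator M (\<lambda>\<omega>. cmult (Z1 \<omega>) (Z2 \<omega>))"
proof -
  interpret prob_space M using assms(1) by (rule generatorD)
  note [measurable] = generatorD(2)[OF assms(1)] generatorD(2)[OF assms(2)]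
  have "(\<integral>\<omega>. Z1 \<omega> $ i * Z2 \<omega> $ i \<partial>M) = 1" for i
  proof -
    have "indep_var borel (\<lambda>\<omega>. Z1 \<omega> $ i) borel (\<lambda>\<omega>. Z2 \<omega> $ i)"
      using indep_var_compose[OF assms(3), of "\<lambda>x. x $ i" borel "\<lambda>x. x $ i" borel]
      by (simp add: comp_def)
    from indep_var_lebesgue_integral[OF this] show ?thesis
      using generatorD(4,5)[OF assms(1)] generatorD(4,5)[OF assms(2)] by simp
  qed
  moreover have "AE \<omega> in M. 0 \<le> Z1 \<omega> $ i * Z2 \<omega> $ i" for i
    using generatorD(3)[OF assms(1)] generatorD(3)[OF assms(2)] by eventually_elim simp
  ultimately show ?thesis
    using prob_space_axioms borel_measurable_cmult[of Z1 M Z2]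
    by (simp add: generator_def) (simp add: cmult_def)
qed

lemma integrable_MAX:
  assumes "generator M Z"
  shows "integrable M (\<lambda>\<omega>. MAX i. \<bar>x $ i\<bar> * Z \<omega> $ i)"
proof (rule Bochner_Integration.integrable_bound)
  note [measurable] = generatorD(2)[OF assms]
  show "integrable M (\<lambda>\<omega>. \<Sum>i\<in>UNIV. \<bar>x $ i\<bar> * Z \<omega> $ i)"
    using generatorD(5)[OF assms] by simp
  show "(\<lambda>\<omega>. MAX i. \<bar>x $ i\<bar> * Z \<omega> $ i) \<in> borel_measurable M"
    by measurable
  show "AE \<omega> in M. norm (MAX i. \<bar>x $ i\<bar> * Z \<omega> $ i) \<le> norm (\<Sum>i\<in>UNIV. \<bar>x $ i\<bar> * Z \<omega> $ i)"
    using generatorD(3)[OF assms]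
  proof eventually_elim
    case (elim \<omega>)
    have "(MAX i. \<bar>x $ i\<bar> * Z \<omega> $ i) \<in> range (\<lambda>i. \<bar>x $ i\<bar> * Z \<omega> $ i)"
      by (rule Max_in) auto
    then obtain j where "(MAX i. \<bar>x $ i\<bar> * Z \<omega> $ i) = \<bar>x $ j\<bar> * Z \<omega> $ j"
      by (rule imageE)
    moreover have "\<bar>x $ j\<bar> * Z \<omega> $ j \<le> (\<Sum>i\<in>UNIV. \<bar>x $ i\<bar> * Z \<omega> $ i)"
      using elim by (intro member_le_sum) auto
    moreover have "0 \<le> \<bar>x $ j\<bar> * Z \<omega> $ j" using elim by simp
    ultimately show ?case by simp
  qed
qed

lemma D_norm_cmult_eq:
  assumes "generator M Z1" "generator M Z2" "prob_space.indep_var M borel Z1 borel Z2"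
  shows "D_norm M (\<lambda>\<omega>. cmult (Z1 \<omega>) (Z2 \<omega>)) x = (\<integral>\<omega>. D_norm M Z1 (cmult x (Z2 \<omega>)) \<partial>M)"
    and "D_norm M (\<lambda>\<omega>. cmult (Z1 \<omega>) (Z2 \<omega>)) x = (\<integral>\<omega>. D_norm M Z2 (cmult x (Z1 \<omega>)) \<partial>M)"
proof -
  interpret prob_space M using assms(1) by (rule generatorD)
  note [measurable] = generatorD(2)[OF assms(1)] generatorD(2)[OF assms(2)]
  define N1 where "N1 = distr M borel Z1"
  define N2 where "N2 = distr M borel Z2"
  define K where "K a b = (MAX i. \<bar>x $ i\<bar> * (a $ i * b $ i))" for a b :: "real ^ 'b"
  have [measurable_cong]: "sets N1 = sets borel" "sets N2 = sets borel"
    by (auto simp: N1_def N2_def)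
  interpret N1: prob_space N1 unfolding N1_def by (rule prob_space_distr) simp
  interpret N2: prob_space N2 unfolding N2_def by (rule prob_space_distr) simp
  interpret pair_sigma_finite N1 N2 ..
  have J: "N1 \<Otimes>\<^sub>M N2 = distr M (borel \<Otimes>\<^sub>M borel) (\<lambda>\<omega>. (Z1 \<omega>, Z2 \<omega>))"
    using assms(3) unfolding indep_var_distribution_eq N1_def N2_def by simp
  have K_meas [measurable]: "(\<lambda>(a, b). K a b) \<in> borel_measurable (borel \<Otimes>\<^sub>M borel)"
    unfolding K_def by measurable
  have "integrable M (\<lambda>\<omega>. K (Z1 \<omega>) (Z2 \<omega>))"
    using integrable_MAX[OF generator_cmult[OF assms]] by (simp add: K_def cmult_def)
  then have int: "integrable (N1 \<Otimes>\<^sub>M N2) (\<lambda>(a, b). K a b)"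
    unfolding J by (subst integrable_distr_eq) (auto simp: K_meas)
  have eq: "D_norm M (\<lambda>\<omega>. cmult (Z1 \<omega>) (Z2 \<omega>)) x = integral\<^sup>L (N1 \<Otimes>\<^sub>M N2) (\<lambda>(a, b). K a b)"
    unfolding J by (subst integral_distr) (auto simp: K_meas D_norm_def K_def cmult_def)
  have inner1: "(\<integral>a. K a b \<partial>N1) = D_norm M Z1 (cmult x b)" if "\<forall>i. 0 \<le> b $ i" for b
    using that by (simp add: N1_def K_def integral_distr D_norm_def cmult_def abs_mult mult_ac)
  have inner2: "(\<integral>b. K a b \<partial>N2) = D_norm M Z2 (cmult x a)" if "\<forall>i. 0 \<le> a $ i" for a
    using that by (simp add: N2_def K_def integral_distr D_norm_def cmult_def abs_mult mult_ac)
  have "(\<integral>b. (\<integral>a. K a b \<partial>N1) \<partial>N2) = (\<integral>\<omega>. (\<integral>a. K a (Z2 \<omega>) \<partial>N1) \<partial>M)"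
    unfolding N2_def by (rule integral_distr) measurable
  also have "\<dots> = (\<integral>\<omega>. D_norm M Z1 (cmult x (Z2 \<omega>)) \<partial>M)"
  proof (rule integral_cong_AE)
    show "(\<lambda>\<omega>. \<integral>a. K a (Z2 \<omega>) \<partial>N1) \<in> borel_measurable M" by measurable
    show "(\<lambda>\<omega>. D_norm M Z1 (cmult x (Z2 \<omega>))) \<in> borel_measurable M"
      unfolding D_norm_def by measurable
    show "AE \<omega> in M. (\<integral>a. K a (Z2 \<omega>) \<partial>N1) = D_norm M Z1 (cmult x (Z2 \<omega>))"
      using generatorD(3)[OF assms(2)] by eventually_elim (rule inner1)
  qed
  finally show "D_norm M (\<lambda>\<omega>. cmult (Z1 \<omega>) (Z2 \<omega>)) x = (\<integral>\<omega>. D_norm M Z1 (cmult x (Z2 \<omega>)) \<partial>M)"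
    using eq integral_snd[OF int] by simp
  have "(\<integral>a. (\<integral>b. K a b \<partial>N2) \<partial>N1) = (\<integral>\<omega>. (\<integral>b. K (Z1 \<omega>) b \<partial>N2) \<partial>M)"
    unfolding N1_def by (rule integral_distr) measurable
  also have "\<dots> = (\<integral>\<omega>. D_norm M Z2 (cmult x (Z1 \<omega>)) \<partial>M)"
  proof (rule integral_cong_AE)
    show "(\<lambda>\<omega>. \<integral>b. K (Z1 \<omega>) b \<partial>N2) \<in> borel_measurable M" by measurable
    show "(\<lambda>\<omega>. D_norm M Z2 (cmult x (Z1 \<omega>))) \<in> borel_measurable M"
      unfolding D_norm_def by measurable
    show "AE \<omega> in M. (\<integral>b. K (Z1 \<omega>) b \<partial>N2) = D_norm M Z2 (cmult x (Z1 \<omega>))"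
      using generatorD(3)[OF assms(1)] by eventually_elim (rule inner2)
  qed
  finally show "D_norm M (\<lambda>\<omega>. cmult (Z1 \<omega>) (Z2 \<omega>)) x = (\<integral>\<omega>. D_norm M Z2 (cmult x (Z1 \<omega>)) \<partial>M)"
    using eq integral_fst[OF int] by simp
qed

lemma indep_pair:
  fixes Z1 :: "'a \<Rightarrow> real ^ 'n" and Z2 :: "'b \<Rightarrow> real ^ 'n"
  assumes "generator M1 Z1" "generator M2 Z2"
  defines "P \<equiv> distr M1 borel Z1 \<Otimes>\<^sub>M distr M2 borel Z2"
  shows "generator P fst" "generator P snd" "prob_space.indep_var P borel fst borel snd"
    "D_norm P fst = D_norm M1 Z1" "D_norm P snd = D_norm M2 Z2"
    "distr P borel fst = distr M1 borel Z1" "distr P borel snd = distr M2 borel Z2"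
proof -
  define N1 where "N1 = distr M1 borel Z1"
  define N2 where "N2 = distr M2 borel Z2"
  have P: "P = N1 \<Otimes>\<^sub>M N2" by (simp add: P_def N1_def N2_def)
  have [measurable_cong]: "sets N1 = sets borel" "sets N2 = sets borel"
    by (auto simp: N1_def N2_def)
  have g: "generator N1 (\<lambda>x. x)" "generator N2 (\<lambda>x. x)"
    unfolding N1_def N2_def using assms by (auto intro: generator_distr)
  interpret N1: prob_space N1 using g(1) by (rule generatorD)
  interpret N2: prob_space N2 using g(2) by (rule generatorD)
  interpret pair_prob_space N1 N2 ..
  have prob: "prob_space P" unfolding P by unfold_locales
  have m [measurable]: "fst \<in> P \<rightarrow>\<^sub>M borel" "snd \<in> P \<rightarrow>\<^sub>M borel"
    unfolding P by measurable
  have 1: "distr P borel fst = N1"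
  proof (rule measure_eqI)
    fix A assume "A \<in> sets (distr P borel fst)"
    then have A: "A \<in> sets N1" by (simp add: N1_def)
    have "fst -` A \<inter> space P = A \<times> space N2"
      using sets.sets_into_space[OF A] unfolding P by (auto simp: space_pair_measure)
    then show "emeasure (distr P borel fst) A = emeasure N1 A"
      using A m(1) N2.emeasure_pair_measure_Times[of A N1 "space N2"]
      by (simp add: emeasure_distr P N2.emeasure_space_1 \<open>sets N1 = sets borel\<close>)
  qed (simp add: N1_def)
  have 2: "distr P borel snd = N2"
  proof (rule measure_eqI)
    fix A assume "A \<in> sets (distr P borel snd)"
    then have A: "A \<in> sets N2" by (simp add: N2_def)
    have "snd -` A \<inter> space P = space N1 \<times> A"
      using sets.sets_into_space[OF A] unfolding P by (auto simp: space_pair_measure)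
    then show "emeasure (distr P borel snd) A = emeasure N2 A"
      using A m(2) N2.emeasure_pair_measure_Times[of "space N1" N1 A]
      by (simp add: emeasure_distr P N1.emeasure_space_1 \<open>sets N2 = sets borel\<close>)
  qed (simp add: N2_def)
  show "distr P borel fst = distr M1 borel Z1" "distr P borel snd = distr M2 borel Z2"
    using 1 2 by (simp_all add: N1_def N2_def)
  have id: "distr P (borel \<Otimes>\<^sub>M borel) (\<lambda>x. (fst x, snd x)) = P"
  proof -
    have "sets (borel \<Otimes>\<^sub>M borel) = sets P"
      unfolding P by (intro sets_pair_measure_cong) (auto simp: N1_def N2_def)
    then have "distr P (borel \<Otimes>\<^sub>M borel) (\<lambda>x. (fst x, snd x)) = distr P P (\<lambda>x. x)"
      by (intro distr_cong) auto
    then show ?thesis by (simp only: distr_id)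
  qed
  show "prob_space.indep_var P borel fst borel snd"
    unfolding prob_space.indep_var_distribution_eq[OF prob] 1 2 id using m P by blast
  show gen: "generator P fst" "generator P snd"
    by (rule generator_of_distr[OF prob m(1)], unfold 1, rule g(1))
      (rule generator_of_distr[OF prob m(2)], unfold 2, rule g(2))
  show "D_norm P fst = D_norm M1 Z1"
    using generator_distr(2)[OF gen(1)] generator_distr(2)[OF assms(1)]
    unfolding 1 N1_def by (rule trans[OF sym])
  show "D_norm P snd = D_norm M2 Z2"
    using generator_distr(2)[OF gen(2)] generator_distr(2)[OF assms(2)]
    unfolding 2 N2_def by (rule trans[OF sym])
qed

lemma D_norm_cmult_unique:
  fixes Z1 Z2 :: "'a \<Rightarrow> real ^ 'n" and Y1 Y2 :: "'b \<Rightarrow> real ^ 'n"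
  assumes Z: "generator M Z1" "generator M Z2" "prob_space.indep_var M borel Z1 borel Z2"
    and Y: "generator N Y1" "generator N Y2" "prob_space.indep_var N borel Y1 borel Y2"
    and eq: "D_norm M Z1 = D_norm N Y1" "D_norm M Z2 = D_norm N Y2"
  shows "D_norm M (\<lambda>\<omega>. cmult (Z1 \<omega>) (Z2 \<omega>)) = D_norm N (\<lambda>\<omega>. cmult (Y1 \<omega>) (Y2 \<omega>))"
proof
  fix x
  define P where "P = distr N borel Y1 \<Otimes>\<^sub>M distr M borel Z2"
  note P = indep_pair[OF Y(1) Z(2), folded P_def]
  note [measurable] = generatorD(2)[OF Z(1)] generatorD(2)[OF Z(2)]
    generatorD(2)[OF Y(1)] generatorD(2)[OF Y(2)] generatorD(2)[OF P(1)] generatorD(2)[OF P(2)]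
  have meas: "(\<lambda>z. D_norm M Z1 (cmult x z)) \<in> borel_measurable borel"
    "(\<lambda>z. D_norm M Z2 (cmult x z)) \<in> borel_measurable borel"
  proof -
    interpret prob_space M using Z(1) by (rule generatorD)
    show "(\<lambda>z. D_norm M Z1 (cmult x z)) \<in> borel_measurable borel"
      "(\<lambda>z. D_norm M Z2 (cmult x z)) \<in> borel_measurable borel"
      unfolding D_norm_def by measurable
  qed
  have "D_norm M (\<lambda>\<omega>. cmult (Z1 \<omega>) (Z2 \<omega>)) x = (\<integral>\<omega>. D_norm M Z1 (cmult x (Z2 \<omega>)) \<partial>M)"
    by (rule D_norm_cmult_eq(1)[OF Z])
  also have "\<dots> = (\<integral>z. D_norm M Z1 (cmult x z) \<partial>distr P borel snd)"
    unfolding P(7) using meas by (subst integral_distr) auto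
  also have "\<dots> = (\<integral>\<omega>. D_norm P fst (cmult x (snd \<omega>)) \<partial>P)"
    unfolding P(4) eq(1)[symmetric] using meas by (subst integral_distr) auto
  also have "\<dots> = (\<integral>\<omega>. D_norm P snd (cmult x (fst \<omega>)) \<partial>P)"
    using D_norm_cmult_eq[OF P(1,2,3), of x] by simp
  also have "\<dots> = (\<integral>z. D_norm M Z2 (cmult x z) \<partial>distr P borel fst)"
    unfolding P(5) using meas by (subst integral_distr) auto
  also have "\<dots> = (\<integral>\<omega>. D_norm N Y2 (cmult x (Y1 \<omega>)) \<partial>N)"
    unfolding P(6) eq(2)[symmetric] using meas by (subst integral_distr) auto
  also have "\<dots> = D_norm N (\<lambda>\<omega>. cmult (Y1 \<omega>) (Y2 \<omega>)) x"
    by (rule D_norm_cmult_eq(2)[OF Y, symmetric])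
  finally show "D_norm M (\<lambda>\<omega>. cmult (Z1 \<omega>) (Z2 \<omega>)) x = D_norm N (\<lambda>\<omega>. cmult (Y1 \<omega>) (Y2 \<omega>)) x" .
qed

lemma D_prod_eq:
  fixes Z1 Z2 :: "'a \<Rightarrow> real ^ 'n"
  assumes Z: "generator M Z1" "generator M Z2" "prob_space.indep_var M borel Z1 borel Z2"
  shows "D_prod (D_norm M Z1) (D_norm M Z2) = D_norm M (\<lambda>\<omega>. cmult (Z1 \<omega>) (Z2 \<omega>))"
proof -
  define P where "P = distr M borel Z1 \<Otimes>\<^sub>M distr M borel Z2"
  note P = indep_pair[OF Z(1,2), folded P_def]
  have eq: "D_norm M (\<lambda>\<omega>. cmult (Z1 \<omega>) (Z2 \<omega>)) = D_norm P (\<lambda>\<omega>. cmult (fst \<omega>) (snd \<omega>))"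
    using P by (intro D_norm_cmult_unique[OF Z]) simp_all
  show ?thesis
    unfolding D_prod_def
  proof (rule the_equality)
    show "\<exists>(N :: ((real ^ 'n) \<times> (real ^ 'n)) measure) Y1 Y2.
       generator N Y1 \<and> generator N Y2 \<and> prob_space.indep_var N borel Y1 borel Y2 \<and>
       D_norm M Z1 = D_norm N Y1 \<and> D_norm M Z2 = D_norm N Y2 \<and>
       D_norm M (\<lambda>\<omega>. cmult (Z1 \<omega>) (Z2 \<omega>)) = D_norm N (\<lambda>\<omega>. cmult (Y1 \<omega>) (Y2 \<omega>))"
      by (intro exI[of _ P] exI[of _ "fst :: (real ^ 'n) \<times> (real ^ 'n) \<Rightarrow> real ^ 'n"]
        exI[of _ "snd :: (real ^ 'n) \<times> (real ^ 'n) \<Rightarrow> real ^ 'n"] conjI P(1-3) P(4,5)[symmetric] eq)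
  next
    fix r
    assume "\<exists>(N :: ((real ^ 'n) \<times> (real ^ 'n)) measure) Y1 Y2.
       generator N Y1 \<and> generator N Y2 \<and> prob_space.indep_var N borel Y1 borel Y2 \<and>
       D_norm M Z1 = D_norm N Y1 \<and> D_norm M Z2 = D_norm N Y2 \<and>
       r = D_norm N (\<lambda>\<omega>. cmult (Y1 \<omega>) (Y2 \<omega>))"
    then show "r = D_norm M (\<lambda>\<omega>. cmult (Z1 \<omega>) (Z2 \<omega>))"
      by (elim exE conjE) (simp only: D_norm_cmult_unique[OF Z])
  qed
qed

end

theory Submission
  imports Defs
begin

text \<open>Let \<open>Z\<close> generate \<open>p\<close>. Idempotence says \<open>p x = E p(xZ)\<close>, where also \<open>p x = E \<parallel>xZ\<parallel>\<^sub>\<infinity>\<close> and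
  \<open>\<parallel>\<cdot>\<parallel>\<^sub>\<infinity> \<le> p\<close>; hence \<open>p(xZ) = \<parallel>xZ\<parallel>\<^sub>\<infinity>\<close> almost surely, simultaneously for all \<open>x = q e\<^sub>i + e\<^sub>j\<close> with
  rational \<open>q > 0\<close>. If \<open>Z\<^sub>i Z\<^sub>j > 0\<close> with positive probability, letting \<open>q\<close> decrease to \<open>Z\<^sub>j / Z\<^sub>i\<close> at
  one outcome gives \<open>p(e\<^sub>i + e\<^sub>j) \<le> 1\<close>, so \<open>Z\<^sub>i = Z\<^sub>j\<close> almost surely and the bivariate projection is
  the sup-norm. Otherwise \<open>Z\<^sub>i Z\<^sub>j = 0\<close> almost surely for all \<open>i \<noteq> j\<close>, so the maximum
  defining \<open>p\<close> is a sum.\<close>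

section \<open>Elementary bounds for D-norms and their values on pairs of axes\<close>

lemma Max_axis_pair:
  fixes z :: "real ^ 'n"
  assumes "i \<noteq> j" "\<forall>k. 0 \<le> z $ k"
  shows "(MAX k. \<bar>(a *\<^sub>R axis i 1 + b *\<^sub>R axis j 1) $ k\<bar> * z $ k)
    = max (\<bar>a\<bar> * z $ i) (\<bar>b\<bar> * z $ j)"
proof (rule Max_eqI)
  show "max (\<bar>a\<bar> * z $ i) (\<bar>b\<bar> * z $ j)
      \<in> range (\<lambda>k. \<bar>(a *\<^sub>R axis i 1 + b *\<^sub>R axis j 1) $ k\<bar> * z $ k)"
  proof (cases "\<bar>b\<bar> * z $ j \<le> \<bar>a\<bar> * z $ i")
    case True
    then show ?thesis using assms(1) by (intro image_eqI[of _ _ i]) (auto simp: axis_def)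
  next
    case False
    then show ?thesis using assms(1) by (intro image_eqI[of _ _ j]) (auto simp: axis_def)
  qed
next
  fix y assume "y \<in> range (\<lambda>k. \<bar>(a *\<^sub>R axis i 1 + b *\<^sub>R axis j 1) $ k\<bar> * z $ k)"
  then obtain k where y: "y = \<bar>(a *\<^sub>R axis i 1 + b *\<^sub>R axis j 1) $ k\<bar> * z $ k" by auto
  \<comment> \<open>For \<open>k\<close> other than \<open>i\<close> and \<open>j\<close> the entry
    is 0, and nonnegativity of \<open>z\<close> keeps the right-hand side at least 0.\<close>
  show "y \<le> max (\<bar>a\<bar> * z $ i) (\<bar>b\<bar> * z $ j)"
    using assms unfolding y by (auto simp: axis_def max_def)
qed simp

lemma D_norm_axis_pair:
  assumes g: "generator M Z" and "i \<noteq> j"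
  shows "D_norm M Z (a *\<^sub>R axis i 1 + b *\<^sub>R axis j 1)
    = (\<integral>\<omega>. max (\<bar>a\<bar> * Z \<omega> $ i) (\<bar>b\<bar> * Z \<omega> $ j) \<partial>M)"
  unfolding D_norm_def
proof (rule integral_cong_AE)
  note [measurable] = generatorD(2)[OF g]
  show "(\<lambda>\<omega>. MAX k. \<bar>(a *\<^sub>R axis i 1 + b *\<^sub>R axis j 1) $ k\<bar> * Z \<omega> $ k) \<in> borel_measurable M"
    "(\<lambda>\<omega>. max (\<bar>a\<bar> * Z \<omega> $ i) (\<bar>b\<bar> * Z \<omega> $ j)) \<in> borel_measurable M"
    by measurable
  show "AE \<omega> in M. (MAX k. \<bar>(a *\<^sub>R axis i 1 + b *\<^sub>R axis j 1) $ k\<bar> * Z \<omega> $ k)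
      = max (\<bar>a\<bar> * Z \<omega> $ i) (\<bar>b\<bar> * Z \<omega> $ j)"
    using generatorD(3)[OF g] by eventually_elim (rule Max_axis_pair[OF \<open>i \<noteq> j\<close>])
qed

lemma D_norm_scaleR:
  assumes "0 \<le> c"
  shows "D_norm M Z (c *\<^sub>R x) = c * D_norm M Z x"
proof -
  have "(MAX i. \<bar>(c *\<^sub>R x) $ i\<bar> * Z \<omega> $ i) = c * (MAX i. \<bar>x $ i\<bar> * Z \<omega> $ i)" for \<omega>
    using assms mono_Max_commute[of "(*) c" "range (\<lambda>i. \<bar>x $ i\<bar> * Z \<omega> $ i)"]
    by (simp add: mono_def mult_left_mono abs_mult image_image mult.assoc)
  then show ?thesis by (simp add: D_norm_def)
qed

lemma D_norm_mono:
  assumes g: "generator M Z" and le: "\<And>i. \<bar>x $ i\<bar> \<le> \<bar>y $ i\<bar>"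
  shows "D_norm M Z x \<le> D_norm M Z y"
  unfolding D_norm_def
proof (rule integral_mono_AE[OF integrable_MAX[OF g] integrable_MAX[OF g]])
  show "AE \<omega> in M. (MAX i. \<bar>x $ i\<bar> * Z \<omega> $ i) \<le> (MAX i. \<bar>y $ i\<bar> * Z \<omega> $ i)"
    using generatorD(3)[OF g]
  proof eventually_elim
    case (elim \<omega>)
    show ?case
    proof (rule Max.boundedI)
      fix v assume "v \<in> range (\<lambda>i. \<bar>x $ i\<bar> * Z \<omega> $ i)"
      then obtain i where v: "v = \<bar>x $ i\<bar> * Z \<omega> $ i" by auto
      have "v \<le> \<bar>y $ i\<bar> * Z \<omega> $ i"
        unfolding v using le elim by (intro mult_right_mono) auto
      also have "\<dots> \<le> (MAX i. \<bar>y $ i\<bar> * Z \<omega> $ i)" by (rule Max_ge) auto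
      finally show "v \<le> (MAX i. \<bar>y $ i\<bar> * Z \<omega> $ i)" .
    qed auto
  qed
qed

text \<open>The \<open>i\<close>-th term under the maximum integrates to the left-hand side, because
  \<open>Z\<close> has mean 1 in each coordinate. Taken over all \<open>i\<close>, this bounds the
  D-norm below by the sup-norm.\<close>

lemma D_norm_ge_nth:
  assumes g: "generator M Z"
  shows "\<bar>x $ i\<bar> \<le> D_norm M Z x"
proof -
  have "\<bar>x $ i\<bar> = (\<integral>\<omega>. \<bar>x $ i\<bar> * Z \<omega> $ i \<partial>M)"
    using generatorD(4)[OF g] by simp
  also have "\<dots> \<le> D_norm M Z x"
    unfolding D_norm_def using generatorD(5)[OF g]
    by (intro integral_mono integrable_MAX[OF g]) auto
  finally show ?thesis .
qed

text \<open>A maximum of nonnegative terms is at most their sum, and all means are 1. This later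
  supplies an integrable majorant.\<close>

lemma D_norm_le_l1_norm:
  assumes g: "generator M Z"
  shows "D_norm M Z x \<le> l1_norm x"
proof -
  have "D_norm M Z x \<le> (\<integral>\<omega>. (\<Sum>i\<in>UNIV. \<bar>x $ i\<bar> * Z \<omega> $ i) \<partial>M)"
    unfolding D_norm_def
  proof (rule integral_mono_AE[OF integrable_MAX[OF g]])
    show "AE \<omega> in M. (MAX i. \<bar>x $ i\<bar> * Z \<omega> $ i) \<le> (\<Sum>i\<in>UNIV. \<bar>x $ i\<bar> * Z \<omega> $ i)"
      using generatorD(3)[OF g]
      by eventually_elim (auto intro!: Max.boundedI member_le_sum)
  qed (use generatorD(5)[OF g] in simp)
  also have "\<dots> = l1_norm x"
    using generatorD(4,5)[OF g] by (simp add: l1_norm_def)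
  finally show ?thesis .
qed

section \<open>Integrability and the square of a D-norm\<close>

lemma borel_measurable_D_norm:
  assumes "generator M Z"
  shows "D_norm M Z \<in> borel_measurable borel"
proof -
  interpret prob_space M using assms by (rule generatorD)
  note [measurable] = generatorD(2)[OF assms]
  show ?thesis unfolding D_norm_def by measurable
qed

lemma integrable_D_norm_cmult:
  assumes g: "generator M Z" and h: "generator N W"
  shows "integrable M (\<lambda>\<omega>. D_norm N W (cmult x (Z \<omega>)))"
proof (rule Bochner_Integration.integrable_bound)
  note [measurable] = generatorD(2)[OF g] borel_measurable_D_norm[OF h]
  show "integrable M (\<lambda>\<omega>. l1_norm (cmult x (Z \<omega>)))"
    using generatorD(5)[OF g] by (simp add: l1_norm_def cmult_def abs_mult)
  show "(\<lambda>\<omega>. D_norm N W (cmult x (Z \<omega>))) \<in> borel_measurable M"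
    by measurable
  \<comment> \<open>The index \<open>undefined\<close> is arbitrary: the lower bound by any one
    coordinate shows that the D-norm is nonnegative.\<close>
  have "norm (D_norm N W y) \<le> norm (l1_norm y)" for y
    using D_norm_le_l1_norm[OF h, of y] D_norm_ge_nth[OF h, of y undefined] by simp
  then show "AE \<omega> in M. norm (D_norm N W (cmult x (Z \<omega>))) \<le> norm (l1_norm (cmult x (Z \<omega>)))"
    by simp
qed

text \<open>Independent copies of \<open>Z\<close> are the two projections from the product of its
  law with itself. Integrating out the first leaves its D-norm at \<open>cmult x\<close> of the
  second; that integral depends only on the law of \<open>Z\<close>, so it can be taken over
  \<open>M\<close>.\<close>

lemma D_prod_self_eq:
  fixes Z :: "'a \<Rightarrow> real ^ 'n"
  assumes g: "generator M Z"
  shows "D_prod (D_norm M Z) (D_norm M Z) x = (\<integral>\<omega>. D_norm M Z (cmult x (Z \<omega>)) \<partial>M)"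
proof -
  define P where "P = distr M borel Z \<Otimes>\<^sub>M distr M borel Z"
  note P = indep_pair[OF g g, folded P_def]
  note [measurable] = borel_measurable_D_norm[OF g] generatorD(2)[OF g] generatorD(2)[OF P(2)]
  have "D_prod (D_norm M Z) (D_norm M Z) x = (\<integral>\<omega>. D_norm M Z (cmult x (snd \<omega>)) \<partial>P)"
    using fun_cong[OF D_prod_eq[OF P(1-3)], of x] D_norm_cmult_eq(1)[OF P(1-3), of x]
    by (simp add: P(4,5))
  also have "\<dots> = (\<integral>z. D_norm M Z (cmult x z) \<partial>distr P borel snd)"
    by (rule integral_distr[symmetric]) measurable
  also have "\<dots> = (\<integral>\<omega>. D_norm M Z (cmult x (Z \<omega>)) \<partial>M)"
    unfolding P(7) by (rule integral_distr) measurable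
  finally show ?thesis .
qed

section \<open>Almost sure consequences of idempotence\<close>

lemma integral_eq_imp_AE_eq:
  fixes f g :: "'a \<Rightarrow> real"
  assumes "integrable M f" "integrable M g" "AE x in M. f x \<le> g x"
    and "(\<integral>x. f x \<partial>M) = (\<integral>x. g x \<partial>M)"
  shows "AE x in M. f x = g x"
proof -
  have "AE x in M. g x - f x = 0"
    using assms by (subst integral_nonneg_eq_0_iff_AE[symmetric]) auto
  then show ?thesis by eventually_elim simp
qed

text \<open>The maximum never exceeds the D-norm almost surely, and both integrate to
  \<open>D_norm M Z x\<close>: one by definition, the other by idempotence. The exceptional null set
  depends on \<open>x\<close>.\<close>

lemma idempotent_AE_D_norm_eq:
  fixes Z :: "'a \<Rightarrow> real ^ 'n"
  assumes g: "generator M Z" and idem: "idempotent_D_norm (D_norm M Z)"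
  shows "AE \<omega> in M. D_norm M Z (cmult x (Z \<omega>)) = (MAX i. \<bar>x $ i\<bar> * Z \<omega> $ i)"
proof -
  have "AE \<omega> in M. (MAX i. \<bar>x $ i\<bar> * Z \<omega> $ i) = D_norm M Z (cmult x (Z \<omega>))"
  proof (rule integral_eq_imp_AE_eq[OF integrable_MAX[OF g] integrable_D_norm_cmult[OF g g]])
    show "AE \<omega> in M. (MAX i. \<bar>x $ i\<bar> * Z \<omega> $ i) \<le> D_norm M Z (cmult x (Z \<omega>))"
      using generatorD(3)[OF g]
    proof eventually_elim
      case (elim \<omega>)
      have "\<bar>x $ i\<bar> * Z \<omega> $ i \<le> D_norm M Z (cmult x (Z \<omega>))" for i
        using D_norm_ge_nth[OF g, of "cmult x (Z \<omega>)" i] elim by (simp add: cmult_def abs_mult)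
      then show ?case by (auto intro!: Max.boundedI)
    qed
    show "(\<integral>\<omega>. (MAX i. \<bar>x $ i\<bar> * Z \<omega> $ i) \<partial>M) = (\<integral>\<omega>. D_norm M Z (cmult x (Z \<omega>)) \<partial>M)"
      using D_prod_self_eq[OF g, of x] idem by (simp add: idempotent_D_norm_def D_norm_def)
  qed
  then show ?thesis by eventually_elim simp
qed

lemma idempotent_pair_le_1:
  fixes Z :: "'a \<Rightarrow> real ^ 'n"
  assumes g: "generator M Z" and idem: "idempotent_D_norm (D_norm M Z)" and "i \<noteq> j"
    and nz: "\<not> (AE \<omega> in M. Z \<omega> $ i * Z \<omega> $ j = 0)"
  shows "D_norm M Z (axis i 1 + axis j 1) \<le> 1"
proof -
  let ?x = "\<lambda>a b. a *\<^sub>R axis i 1 + b *\<^sub>R axis j 1 :: real ^ 'n"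
  \<comment> \<open>Restricting to rational coefficients leaves countably many null sets, so one
    outcome can serve all of them.\<close>
  have "AE \<omega> in M. \<forall>q::rat. D_norm M Z (cmult (?x (of_rat q) 1) (Z \<omega>))
      = (MAX k. \<bar>?x (of_rat q) 1 $ k\<bar> * Z \<omega> $ k)"
    unfolding AE_all_countable by (intro allI idempotent_AE_D_norm_eq[OF g idem])
  then have ae: "AE \<omega> in M. (\<forall>k. 0 \<le> Z \<omega> $ k) \<and>
      (\<forall>q::rat. D_norm M Z (?x (of_rat q * Z \<omega> $ i) (Z \<omega> $ j))
        = max (\<bar>of_rat q\<bar> * Z \<omega> $ i) (Z \<omega> $ j))"
    using generatorD(3)[OF g]
  proof eventually_elim
    case (elim \<omega>)
    have "cmult (?x a 1) (Z \<omega>) = ?x (a * Z \<omega> $ i) (Z \<omega> $ j)" for a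
      using \<open>i \<noteq> j\<close> by (auto simp: cmult_def vec_eq_iff axis_def)
    then show ?case
      using elim Max_axis_pair[OF \<open>i \<noteq> j\<close> elim(2), of _ 1] by simp
  qed
  \<comment> \<open>By \<open>nz\<close> the almost sure properties hold at some outcome with
    nonzero product. From there on the argument is deterministic.\<close>
  have "\<exists>\<omega>. (\<forall>k. 0 \<le> Z \<omega> $ k) \<and>
      (\<forall>q::rat. D_norm M Z (?x (of_rat q * Z \<omega> $ i) (Z \<omega> $ j))
        = max (\<bar>of_rat q\<bar> * Z \<omega> $ i) (Z \<omega> $ j)) \<and> Z \<omega> $ i * Z \<omega> $ j \<noteq> 0"
  proof (rule ccontr)
    assume "\<not> ?thesis"
    then have "AE \<omega> in M. Z \<omega> $ i * Z \<omega> $ j = 0"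
      by (intro eventually_mono[OF ae]) blast
    with nz show False ..
  qed
  then obtain \<omega> where nn: "\<forall>k. 0 \<le> Z \<omega> $ k"
    and eq: "\<And>q::rat. D_norm M Z (?x (of_rat q * Z \<omega> $ i) (Z \<omega> $ j))
        = max (\<bar>of_rat q\<bar> * Z \<omega> $ i) (Z \<omega> $ j)"
    and "Z \<omega> $ i * Z \<omega> $ j \<noteq> 0" by blast
  define u v where "u = Z \<omega> $ i" and "v = Z \<omega> $ j"
  have pos: "0 < u" "0 < v"
    using nn \<open>Z \<omega> $ i * Z \<omega> $ j \<noteq> 0\<close> by (auto simp: u_def v_def order.strict_iff_order)
  \<comment> \<open>The slack \<open>t\<close> leaves room for a rational \<open>q\<close> with
    \<open>q * u\<close> strictly between \<open>v\<close> and \<open>t\<close>, since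
    \<open>v / u\<close> itself may be irrational. Letting \<open>t\<close> decrease to
    \<open>v\<close> then removes the slack.\<close>
  have "v * D_norm M Z (axis i 1 + axis j 1) \<le> t" if "v < t" for t
  proof -
    have "v / u < t / u" using pos that by (simp add: divide_strict_right_mono)
    then obtain q where q: "v / u < of_rat q" "of_rat q < t / u"
      using of_rat_dense by blast
    then have qu: "v < of_rat q * u" "of_rat q * u < t"
      using pos by (auto simp: field_simps)
    have "0 < (of_rat q :: real)"
      using pos by (intro order.strict_trans[OF divide_pos_pos q(1)])
    note qu = qu this
    have "v * D_norm M Z (axis i 1 + axis j 1) = D_norm M Z (?x v v)"
      using D_norm_scaleR[of v M Z "axis i 1 + axis j 1"] pos by (simp add: scaleR_add_right)
    \<comment> \<open>Raising the \<open>i\<close>-th coordinate from \<open>v\<close> to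
      \<open>q * u\<close> gives a vector to which \<open>eq\<close> applies; the maximum there is
      \<open>q * u\<close>.\<close>
    also have "\<dots> \<le> D_norm M Z (?x (of_rat q * u) v)"
      using \<open>i \<noteq> j\<close> qu pos by (intro D_norm_mono[OF g]) (auto simp: axis_def)
    also have "\<dots> = of_rat q * u"
      using eq[of q] qu by (simp add: u_def v_def)
    finally show ?thesis using qu by simp
  qed
  then have "v * D_norm M Z (axis i 1 + axis j 1) \<le> v" by (rule dense_ge)
  with pos show ?thesis by simp
qed

section \<open>The two extreme cases: sup-norm projections and the l1-norm\<close>

lemma infnorm_real_2: "infnorm (v :: real ^ 2) = max \<bar>v $ 1\<bar> \<bar>v $ 2\<bar>"
proof -
  have "{\<bar>v $ i\<bar> |i. i \<in> UNIV} = {\<bar>v $ 1\<bar>, \<bar>v $ 2\<bar>}"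
    unfolding UNIV_2 by auto
  then show ?thesis by (simp add: infnorm_cart cSup_eq_Max)
qed

text \<open>By \<open>le\<close>, the maximum of \<open>Z $ i\<close> and \<open>Z $ j\<close> has
  mean at most 1, while it dominates two variables of mean 1. All three therefore agree almost
  surely, and a single factor of mean 1 comes out of the bivariate maximum.\<close>

lemma bivariate_proj_eq_infnorm:
  assumes g: "generator M Z" and "i \<noteq> j" and le: "D_norm M Z (axis i 1 + axis j 1) \<le> 1"
  shows "bivariate_proj (D_norm M Z) i j = infnorm"
proof
  fix v :: "real ^ 2"
  note [measurable] = generatorD(2)[OF g]
  let ?m = "\<lambda>\<omega>. max (Z \<omega> $ i) (Z \<omega> $ j)"
  have int: "integrable M ?m"
    using generatorD(5)[OF g] by auto
  have "(\<integral>\<omega>. ?m \<omega> \<partial>M) \<le> 1"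
    using le D_norm_axis_pair[OF g \<open>i \<noteq> j\<close>, of 1 1] by simp
  moreover have "1 \<le> (\<integral>\<omega>. ?m \<omega> \<partial>M)"
    using integral_mono[OF generatorD(5)[OF g, of i] int] generatorD(4)[OF g, of i] by simp
  ultimately have 1: "(\<integral>\<omega>. ?m \<omega> \<partial>M) = 1" by simp
  have "AE \<omega> in M. Z \<omega> $ k = ?m \<omega>" if "k = i \<or> k = j" for k
    using that 1 generatorD(4,5)[OF g] int by (intro integral_eq_imp_AE_eq) auto
  then have "AE \<omega> in M. Z \<omega> $ i = ?m \<omega>" "AE \<omega> in M. Z \<omega> $ j = ?m \<omega>" by simp_all
  then have eq: "AE \<omega> in M. Z \<omega> $ i = Z \<omega> $ j" by eventually_elim simp
  have "bivariate_proj (D_norm M Z) i j v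
      = (\<integral>\<omega>. max (\<bar>v $ 1\<bar> * Z \<omega> $ i) (\<bar>v $ 2\<bar> * Z \<omega> $ j) \<partial>M)"
    by (simp add: bivariate_proj_def D_norm_axis_pair[OF g \<open>i \<noteq> j\<close>])
  also have "\<dots> = (\<integral>\<omega>. max \<bar>v $ 1\<bar> \<bar>v $ 2\<bar> * Z \<omega> $ i \<partial>M)"
  proof (rule integral_cong_AE)
    show "AE \<omega> in M. max (\<bar>v $ 1\<bar> * Z \<omega> $ i) (\<bar>v $ 2\<bar> * Z \<omega> $ j) = max \<bar>v $ 1\<bar> \<bar>v $ 2\<bar> * Z \<omega> $ i"
      using eq generatorD(3)[OF g]
      by eventually_elim (simp add: max_mult_distrib_right)
  qed measurable
  also have "\<dots> = infnorm v"
    using generatorD(4)[OF g] by (simp add: infnorm_real_2)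
  finally show "bivariate_proj (D_norm M Z) i j v = infnorm v" .
qed

text \<open>Almost surely at most one coordinate of \<open>Z\<close> is nonzero, so the maximum
  coincides with the sum, whose mean is the l1-norm.\<close>

lemma D_norm_eq_l1_norm:
  fixes Z :: "'a \<Rightarrow> real ^ 'n"
  assumes g: "generator M Z" and zero: "\<And>i j. i \<noteq> j \<Longrightarrow> AE \<omega> in M. Z \<omega> $ i * Z \<omega> $ j = 0"
  shows "D_norm M Z = l1_norm"
proof
  fix x
  note [measurable] = generatorD(2)[OF g]
  have "AE \<omega> in M. \<forall>i j. i \<noteq> j \<longrightarrow> Z \<omega> $ i * Z \<omega> $ j = 0"
    using zero by (simp add: AE_all_countable)
  then have "AE \<omega> in M. (MAX i. \<bar>x $ i\<bar> * Z \<omega> $ i) = (\<Sum>i\<in>UNIV. \<bar>x $ i\<bar> * Z \<omega> $ i)"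
    using generatorD(3)[OF g]
  proof eventually_elim
    case (elim \<omega>)
    \<comment> \<open>If all coordinates vanish, any index serves as \<open>k\<close>.\<close>
    obtain k where k: "\<And>i. i \<noteq> k \<Longrightarrow> Z \<omega> $ i = 0"
      using elim(1) by (metis mult_eq_0_iff)
    have "(MAX i. \<bar>x $ i\<bar> * Z \<omega> $ i) = \<bar>x $ k\<bar> * Z \<omega> $ k"
    proof (rule Max_eqI)
      fix y assume "y \<in> range (\<lambda>i. \<bar>x $ i\<bar> * Z \<omega> $ i)"
      then obtain i where "y = \<bar>x $ i\<bar> * Z \<omega> $ i" by auto
      then show "y \<le> \<bar>x $ k\<bar> * Z \<omega> $ k" using k[of i] elim(2) by (cases "i = k") auto
    qed auto
    also have "\<dots> = (\<Sum>i\<in>{k}. \<bar>x $ i\<bar> * Z \<omega> $ i)" by simp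
    also have "\<dots> = (\<Sum>i\<in>UNIV. \<bar>x $ i\<bar> * Z \<omega> $ i)"
      using k by (intro sum.mono_neutral_left) auto
    finally show ?case .
  qed
  then have "D_norm M Z x = (\<integral>\<omega>. (\<Sum>i\<in>UNIV. \<bar>x $ i\<bar> * Z \<omega> $ i) \<partial>M)"
    unfolding D_norm_def by (intro integral_cong_AE) measurable
  also have "\<dots> = l1_norm x"
    using generatorD(4,5)[OF g] by (simp add: l1_norm_def)
  finally show "D_norm M Z x = l1_norm x" .
qed

text \<open>On nonnegative vectors \<open>z\<close>, \<open>l1_norm (cmult x z)\<close> is linear in
  \<open>z\<close>, so its mean along a generator is its value at the all-ones vector,
  \<open>l1_norm x\<close>. The assumption supplies the generator; in the theorem it is inherited
  from \<open>p\<close>.\<close>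

lemma idempotent_l1_norm:
  assumes "is_D_norm (l1_norm :: real ^ 'n \<Rightarrow> real)"
  shows "idempotent_D_norm (l1_norm :: real ^ 'n \<Rightarrow> real)"
proof -
  obtain M :: "(real ^ 'n) measure" and Z :: "real ^ 'n \<Rightarrow> real ^ 'n"
    where g: "generator M Z" and eq: "l1_norm = D_norm M Z"
    using assms unfolding is_D_norm_def by blast
  have "D_prod l1_norm l1_norm x = l1_norm x" for x :: "real ^ 'n"
  proof -
    note [measurable] = generatorD(2)[OF g]
    have meas: "(\<lambda>\<omega>. l1_norm (cmult x (Z \<omega>))) \<in> borel_measurable M"
      unfolding l1_norm_def by measurable
    have "D_prod l1_norm l1_norm x = (\<integral>\<omega>. l1_norm (cmult x (Z \<omega>)) \<partial>M)"
      using D_prod_self_eq[OF g, of x] by (simp add: eq)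
    also have "\<dots> = (\<integral>\<omega>. (\<Sum>i\<in>UNIV. \<bar>x $ i\<bar> * Z \<omega> $ i) \<partial>M)"
    proof (rule integral_cong_AE[OF meas])
      show "AE \<omega> in M. l1_norm (cmult x (Z \<omega>)) = (\<Sum>i\<in>UNIV. \<bar>x $ i\<bar> * Z \<omega> $ i)"
        using generatorD(3)[OF g]
        by eventually_elim (simp add: l1_norm_def cmult_def abs_mult)
    qed measurable
    also have "\<dots> = l1_norm x"
      using generatorD(4,5)[OF g] by (simp add: l1_norm_def)
    finally show ?thesis .
  qed
  with assms show ?thesis by (auto simp: idempotent_D_norm_def)
qed

theorem proposition3p4:
  fixes p :: "real ^ 'n \<Rightarrow> real"
  assumes "CARD('n) \<ge> 2"
    and "is_D_norm p"
    and "\<And>i j. i \<noteq> j \<Longrightarrow> bivariate_proj p i j \<noteq> infnorm"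
  shows "idempotent_D_norm p \<longleftrightarrow> p = l1_norm"
proof
  assume idem: "idempotent_D_norm p"
  obtain M :: "(real ^ 'n) measure" and Z where g: "generator M Z" and p: "p = D_norm M Z"
    using assms(2) unfolding is_D_norm_def by blast
  \<comment> \<open>By contradiction: a product that is not almost surely zero would force the
    excluded sup-norm projection.\<close>
  have "AE \<omega> in M. Z \<omega> $ i * Z \<omega> $ j = 0" if "i \<noteq> j" for i j
    using idempotent_pair_le_1[OF g idem[unfolded p] that]
      bivariate_proj_eq_infnorm[OF g that] assms(3)[OF that] unfolding p by blast
  then show "p = l1_norm"
    unfolding p by (rule D_norm_eq_l1_norm[OF g])
next
  assume "p = l1_norm"
  with assms(2) show "idempotent_D_norm p" by (simp add: idempotent_l1_norm)
qed

end
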